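(* Let $(U,\Lambda,D,V)$ be an analytic problem with an MRD discretization of $V$ that is well-posed with respect to a norm $\|\cdot\|_{WP}$ on $U$ with constant $C$, i.e. $\|u\|_{WP}\le C\|Du\|_V$ for all $u\in U$. Let $U_M\subseteq U$ be a finite-dimensional subspace, and let $(R_N,V_N)$ be an admissible restriction with $$\|u_M\|_D\le 2\,\|R_ND(u_M)\|_{V_N}\quad\text{for all }u_M\in U_M .$$ Let $u^*\in U$, let $C_A\ge 1$, let $u_M^*\in U_M$ be any comparison trial object, and let $\tilde u_M\in U_M$ satisfy $$\|R_ND(u^*-\tilde u_M)\|_{V_N}\le C_A\,\|R_ND(u^*-u_M^* )\|_{V_N}.$$ Then $$\|u^*-\tilde u_M\|_{WP}\le C(2C_A+3)\,\|u_M^*-u^*\|_D .$$ (Thus convergence rates of $u_M^*$ to $u^*$ in the data norm transfer, with the constants $C$ and $C_A$ fixed, to the same convergence rates of $\tilde u_M$ to $u^*$ in the norm $\|\cdot\|_{WP}$.)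
   Context: Analytic problem: a real normed linear space $U$ (objects), a set $\Lambda$ of linear functionals on $U$, the data map $D:U\to\mathbb{R}^\Lambda$, $D(u)=\{\lambda(u)\}_{\lambda\in\Lambda}$, and a normed data space $V\subseteq\mathbb{R}^\Lambda$ containing $D(U)$ whose norm satisfies $\|Du\|_V=\sup_{\lambda\in\Lambda}|\lambda(u)|<\infty$ for all $u\in U$. Put $\|u\|_D:=\|Du\|_V$ (a seminorm on $U$). MRD (monotone refinable dense) discretization of a normed data space $V$: a (nonempty) set of pairs $(R_N,V_N)$, called admissible restrictions, together with a relation $\preceq$ (refinement) on them, such that (1) each $V_N$ is a finite-dimensional real normed space with norm $\|\cdot\|_{V_N}$; (2) each $R_N:V\to V_N$ is linear; (3) (monotonicity) $(R_M,V_M)\preceq(R_N,V_N)$ implies $\|R_Mv\|_{V_M}\le\|R_Nv\|_{V_N}$ for all $v\in V$; (4) (refinement) for any two admissible restrictions $(R_M,V_M)$, $(R_N,V_N)$ there is an admissible restriction $(R_P,V_P)$ with $(R_M,V_M)\preceq(R_P,V_P)$ and $(R_N,V_N)\preceq(R_P,V_P)$; (5) (density) $\|v\|_V=\sup\|R_Nv\|_{V_N}$ for all $v\in V$, the supremum being over all admissible restrictions. *)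

theory Defs
  imports "HOL-Analysis.Analysis" "HOL-Library.Function_Algebras" "HOL-Library.Landau_Symbols"
begin

text \<open>Pointwise real vector space structure on functions, so that \<open>\<real>\<^sup>\<Lambda>\<close> is a vector space.\<close>

instantiation "fun" :: (type, real_vector) real_vector
begin

definition scaleR_fun :: "real \<Rightarrow> ('a \<Rightarrow> 'b) \<Rightarrow> 'a \<Rightarrow> 'b"
  where "scaleR_fun c f = (\<lambda>x. c *\<^sub>R f x)"

instance
  by standard (simp_all add: scaleR_fun_def fun_eq_iff algebra_simps)

end

text \<open>
  Spaces whose carrier may depend on an index (the data space \<open>V\<close> and the spaces \<open>V\<^sub>N\<close>) are
  linear subspaces of an ambient real vector space, each with its own norm. The values of the
  norm outside the carrier are irrelevant.
\<close>

record 'a nspace =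
  pts :: "'a set"
  nrm :: "'a \<Rightarrow> real"

definition norm_on :: "'a::real_vector set \<Rightarrow> ('a \<Rightarrow> real) \<Rightarrow> bool" where
  "norm_on S n \<longleftrightarrow>
     (\<forall>x\<in>S. 0 \<le> n x) \<and>
     (\<forall>x\<in>S. n x = 0 \<longleftrightarrow> x = 0) \<and>
     (\<forall>c. \<forall>x\<in>S. n (c *\<^sub>R x) = \<bar>c\<bar> * n x) \<and>
     (\<forall>x\<in>S. \<forall>y\<in>S. n (x + y) \<le> n x + n y)"

definition normed_space :: "'a::real_vector nspace \<Rightarrow> bool" where
  "normed_space X \<longleftrightarrow> subspace (pts X) \<and> norm_on (pts X) (nrm X)"

definition finite_dim :: "'a::real_vector set \<Rightarrow> bool" where
  "finite_dim S \<longleftrightarrow> (\<exists>B. finite B \<and> S = span B)"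

definition linear_between ::
    "'a::real_vector set \<Rightarrow> 'b::real_vector set \<Rightarrow> ('a \<Rightarrow> 'b) \<Rightarrow> bool" where
  "linear_between S T f \<longleftrightarrow>
     f ` S \<subseteq> T \<and>
     (\<forall>x\<in>S. \<forall>y\<in>S. f (x + y) = f x + f y) \<and>
     (\<forall>c. \<forall>x\<in>S. f (c *\<^sub>R x) = c *\<^sub>R f x)"


text \<open>Elements of \<open>\<real>\<^sup>\<Lambda>\<close> are represented by functions on all functionals that vanish off \<open>\<Lambda>\<close>.\<close>

type_synonym 'u data = "('u \<Rightarrow> real) \<Rightarrow> real"

definition data_vectors :: "('u \<Rightarrow> real) set \<Rightarrow> 'u data set" where
  "data_vectors \<Lambda> = {v. \<forall>l. l \<notin> \<Lambda> \<longrightarrow> v l = 0}"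

definition data_map :: "('u \<Rightarrow> real) set \<Rightarrow> 'u \<Rightarrow> 'u data" where
  "data_map \<Lambda> u = (\<lambda>l. if l \<in> \<Lambda> then l u else 0)"

text \<open>
  The supremum is taken in \<open>[0,\<infinity>]\<close>; as its value is the image of a real number, the equation
  also says that it is finite. For empty \<open>\<Lambda>\<close> it is 0.
\<close>

definition analytic_problem ::
    "('u::real_normed_vector \<Rightarrow> real) set \<Rightarrow> 'u data nspace \<Rightarrow> bool" where
  "analytic_problem \<Lambda> V \<longleftrightarrow>
     (\<forall>l\<in>\<Lambda>. linear l) \<and>
     pts V \<subseteq> data_vectors \<Lambda> \<and> normed_space V \<and>
     range (data_map \<Lambda>) \<subseteq> pts V \<and>
     (\<forall>u. ennreal (nrm V (data_map \<Lambda> u)) = (SUP l\<in>\<Lambda>. ennreal \<bar>l u\<bar>))"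

definition dnorm :: "('u \<Rightarrow> real) set \<Rightarrow> 'u data nspace \<Rightarrow> 'u \<Rightarrow> real" where
  "dnorm \<Lambda> V u = nrm V (data_map \<Lambda> u)"


type_synonym ('v, 'w) restriction = "('v \<Rightarrow> 'w) \<times> 'w nspace"

definition rnorm :: "('v, 'w) restriction \<Rightarrow> 'v \<Rightarrow> real" where
  "rnorm \<rho> v = nrm (snd \<rho>) (fst \<rho> v)"

definition MRD_discretization ::
    "'v::real_vector nspace \<Rightarrow> ('v, 'w::real_vector) restriction set \<Rightarrow>
     (('v, 'w) restriction \<Rightarrow> ('v, 'w) restriction \<Rightarrow> bool) \<Rightarrow> bool" where
  "MRD_discretization V Adm refined_by \<longleftrightarrow>
     Adm \<noteq> {} \<and>
     (\<forall>(R, W)\<in>Adm. normed_space W \<and> finite_dim (pts W)) \<and>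
     (\<forall>(R, W)\<in>Adm. linear_between (pts V) (pts W) R) \<and>
     (\<forall>\<rho>\<in>Adm. \<forall>\<sigma>\<in>Adm. refined_by \<rho> \<sigma> \<longrightarrow> (\<forall>v\<in>pts V. rnorm \<rho> v \<le> rnorm \<sigma> v)) \<and>
     (\<forall>\<rho>\<in>Adm. \<forall>\<sigma>\<in>Adm. \<exists>\<tau>\<in>Adm. refined_by \<rho> \<tau> \<and> refined_by \<sigma> \<tau>) \<and>
     (\<forall>v\<in>pts V. ennreal (nrm V v) = (SUP \<rho>\<in>Adm. ennreal (rnorm \<rho> v)))"

definition well_posed ::
    "('u::real_normed_vector \<Rightarrow> real) set \<Rightarrow> 'u data nspace \<Rightarrow> ('u \<Rightarrow> real) \<Rightarrow> real \<Rightarrow> bool" where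
  "well_posed \<Lambda> V nWP C \<longleftrightarrow>
     norm_on UNIV nWP \<and> (\<forall>u. nWP u \<le> C * nrm V (data_map \<Lambda> u))"

definition stable_test ::
    "('u \<Rightarrow> real) set \<Rightarrow> 'u data nspace \<Rightarrow> 'u set \<Rightarrow> ('u data, 'w) restriction \<Rightarrow> bool" where
  "stable_test \<Lambda> V UM \<rho> \<longleftrightarrow> (\<forall>u\<in>UM. dnorm \<Lambda> V u \<le> 2 * rnorm \<rho> (data_map \<Lambda> u))"

end

theory Submission
  imports Defs
begin

text \<open>
  The argument is that of Cea's lemma. Both the data norm \<open>d = dnorm \<Lambda> V\<close> and the discrete
  residual norm \<open>r u = rnorm \<rho> (data_map \<Lambda> u)\<close> are seminorms on \<open>U\<close>, because they are norms
  pulled back along linear maps, and \<open>r \<le> d\<close> by the density axiom of the discretization. To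
  bound the error \<open>u - t\<close> of the computed trial object \<open>t\<close>, go through the comparison object \<open>s\<close>.
  The difference \<open>s - t\<close> lies in the trial space, where the stable test reverses \<open>r \<le> d\<close> up to
  the factor 2; and \<open>r (s - t)\<close> splits into the residuals of \<open>s\<close> and \<open>t\<close>, the second of which is at
  most \<open>C_A\<close> times the first, while the first is at most \<open>d (u - s)\<close>. Altogether
  \<open>d (u - t) \<le> (1 + 2 * (1 + C_A)) * d (u - s)\<close> (lemma \<open>stable_trial_quasi_optimal\<close>), and
  well-posedness replaces the data norm of the error by the norm \<open>nWP\<close> at the price of the factor
  \<open>C\<close>. The constants depend neither on the trial space nor on the restriction, so the transfer of
  convergence rates follows by applying the bound to each member of a family.
\<close>

definition seminorm :: "('a::real_vector \<Rightarrow> real) \<Rightarrow> bool" where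
  "seminorm p \<longleftrightarrow>
     (\<forall>x y. p (x + y) \<le> p x + p y) \<and> (\<forall>c x. p (c *\<^sub>R x) = \<bar>c\<bar> * p x)"

lemma seminorm_minus_commute:
  assumes "seminorm p"
  shows "p (x - y) = p (y - x)"
proof -
  have "p ((-1) *\<^sub>R (y - x)) = \<bar>-1\<bar> * p (y - x)"
    using assms unfolding seminorm_def by blast
  then show ?thesis by simp
qed

lemma seminorm_diff_triangle:
  assumes "seminorm p"
  shows "p (x - z) \<le> p (x - y) + p (y - z)"
proof -
  have "p ((x - y) + (y - z)) \<le> p (x - y) + p (y - z)"
    using assms unfolding seminorm_def by blast
  then show ?thesis by simp
qed

lemma seminorm_nonneg:
  assumes "seminorm p"
  shows "0 \<le> p x"
proof -
  have "p (0 *\<^sub>R x) = \<bar>0\<bar> * p x"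
    using assms unfolding seminorm_def by blast
  then have "p 0 = 0" by simp
  moreover have "p (x - x) \<le> p (x - 0) + p (0 - x)"
    by (rule seminorm_diff_triangle[OF assms])
  ultimately show ?thesis
    using seminorm_minus_commute[OF assms, of 0 x] by simp
qed

lemma seminorm_pullback:
  assumes f: "linear f" and S: "range f \<subseteq> S"
    and g: "linear_between S T g" and n: "norm_on T n"
  shows "seminorm (\<lambda>x. n (g (f x)))"
proof -
  have fS: "f x \<in> S" for x using S by blast
  then have gT: "g (f x) \<in> T" for x using g unfolding linear_between_def by blast
  have add: "g (f (x + y)) = g (f x) + g (f y)" for x y
    using g fS linear_add[OF f] unfolding linear_between_def by simp
  have scale: "g (f (c *\<^sub>R x)) = c *\<^sub>R g (f x)" for c x
    using g fS linear_scale[OF f] unfolding linear_between_def by simp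
  show ?thesis
    using n gT by (simp add: seminorm_def norm_on_def add scale)
qed

lemma linear_data_map:
  assumes "analytic_problem \<Lambda> V"
  shows "linear (data_map \<Lambda>)"
proof -
  have lin: "linear l" if "l \<in> \<Lambda>" for l
    using assms that by (simp add: analytic_problem_def)
  show ?thesis
    by (intro linearI)
      (simp_all add: data_map_def scaleR_fun_def fun_eq_iff linear_add[OF lin] linear_scale[OF lin])
qed

lemma data_map_in_pts: "analytic_problem \<Lambda> V \<Longrightarrow> range (data_map \<Lambda>) \<subseteq> pts V"
  by (simp add: analytic_problem_def)

lemma seminorm_dnorm:
  assumes "analytic_problem \<Lambda> V"
  shows "seminorm (dnorm \<Lambda> V)"
proof -
  have "norm_on (pts V) (nrm V)"
    using assms by (simp add: analytic_problem_def normed_space_def)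
  moreover have "linear_between (pts V) (pts V) (\<lambda>v. v)"
    by (simp add: linear_between_def)
  ultimately have "seminorm (\<lambda>u. nrm V (data_map \<Lambda> u))"
    using seminorm_pullback[OF linear_data_map[OF assms] data_map_in_pts[OF assms],
        where g = "\<lambda>v. v"] by blast
  then show ?thesis by (simp add: dnorm_def[abs_def])
qed

lemma seminorm_rnorm:
  assumes "analytic_problem \<Lambda> V" and "MRD_discretization V Adm refined_by" and "\<rho> \<in> Adm"
  shows "seminorm (\<lambda>u. rnorm \<rho> (data_map \<Lambda> u))"
proof -
  have "\<forall>(R, W)\<in>Adm. linear_between (pts V) (pts W) R"
    and "\<forall>(R, W)\<in>Adm. normed_space W \<and> finite_dim (pts W)"
    using assms(2) unfolding MRD_discretization_def by - (elim conjE, assumption)+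
  from this[THEN bspec, OF assms(3)]
  have "linear_between (pts V) (pts (snd \<rho>)) (fst \<rho>)"
    and "norm_on (pts (snd \<rho>)) (nrm (snd \<rho>))"
    by (simp_all add: case_prod_beta normed_space_def)
  then show ?thesis
    unfolding rnorm_def
    by (rule seminorm_pullback[OF linear_data_map[OF assms(1)] data_map_in_pts[OF assms(1)]])
qed

lemma rnorm_le_dnorm:
  assumes ap: "analytic_problem \<Lambda> V" and mrd: "MRD_discretization V Adm refined_by"
    and \<rho>: "\<rho> \<in> Adm"
  shows "rnorm \<rho> (data_map \<Lambda> u) \<le> dnorm \<Lambda> V u"
proof -
  have "data_map \<Lambda> u \<in> pts V" using data_map_in_pts[OF ap] by blast
  then have "ennreal (dnorm \<Lambda> V u) = (SUP \<sigma>\<in>Adm. ennreal (rnorm \<sigma> (data_map \<Lambda> u)))"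
    using mrd unfolding MRD_discretization_def dnorm_def by blast
  then have "ennreal (rnorm \<rho> (data_map \<Lambda> u)) \<le> ennreal (dnorm \<Lambda> V u)"
    using \<rho> by (metis SUP_upper)
  then show ?thesis
    using seminorm_nonneg[OF seminorm_dnorm[OF ap]] by (simp add: ennreal_le_iff)
qed

text \<open>
  In this abstract form \<open>u\<close> is the target, \<open>s\<close> the comparison object and \<open>t\<close> the computed one. The
  strong seminorm \<open>d\<close> is controlled by the weak one \<open>r\<close> only on the vector \<open>s - t\<close>, so \<open>u - t\<close> has to be
  split at \<open>s\<close> in \<open>d\<close>, while \<open>s - t\<close> is split at \<open>u\<close> in \<open>r\<close>, where the near-optimality of \<open>t\<close> applies.
\<close>

lemma stable_trial_quasi_optimal:
  assumes d: "seminorm d" and r: "seminorm r"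
    and le: "\<And>x. r x \<le> d x"
    and stable: "d (s - t) \<le> 2 * r (s - t)"
    and near_opt: "r (u - t) \<le> K * r (u - s)" and K: "0 \<le> K"
  shows "d (u - t) \<le> (2 * K + 3) * d (s - u)"
proof -
  have "d (u - t) \<le> d (u - s) + d (s - t)"
    by (rule seminorm_diff_triangle[OF d])
  also have "\<dots> \<le> d (u - s) + 2 * (r (s - u) + r (u - t))"
    using stable seminorm_diff_triangle[OF r, of s t u] by simp
  also have "\<dots> \<le> d (u - s) + 2 * ((1 + K) * r (u - s))"
    using near_opt seminorm_minus_commute[OF r, of s u] by (simp add: algebra_simps)
  also have "\<dots> \<le> d (u - s) + 2 * ((1 + K) * d (u - s))"
    using le K by (simp add: mult_left_mono)
  also have "\<dots> = (2 * K + 3) * d (s - u)"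
    using seminorm_minus_commute[OF d, of u s] by (simp add: algebra_simps)
  finally show ?thesis .
qed

text \<open>
  The sign of \<open>C\<close> is not prescribed. For negative \<open>C\<close> the well-posedness bound has a nonnegative
  left and a nonpositive right side, which forces the data norm to vanish identically, so
  multiplying a data norm estimate by \<open>C\<close> remains sound.
\<close>

lemma well_posed_bound_mono:
  assumes ap: "analytic_problem \<Lambda> V" and wp: "well_posed \<Lambda> V nWP C"
    and le: "dnorm \<Lambda> V e \<le> K * dnorm \<Lambda> V e'"
  shows "nWP e \<le> C * K * dnorm \<Lambda> V e'"
proof -
  have bound: "0 \<le> nWP x" "nWP x \<le> C * dnorm \<Lambda> V x" for x
    using wp unfolding well_posed_def norm_on_def dnorm_def by auto
  have "C * dnorm \<Lambda> V e \<le> C * (K * dnorm \<Lambda> V e')"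
  proof (cases "0 \<le> C")
    case True
    then show ?thesis using le by (rule mult_left_mono[rotated])
  next
    case False
    have "dnorm \<Lambda> V x = 0" for x
    proof -
      have "0 \<le> C * dnorm \<Lambda> V x" using bound[of x] by linarith
      then show ?thesis
        using False seminorm_nonneg[OF seminorm_dnorm[OF ap], of x]
        by (auto simp: zero_le_mult_iff)
    qed
    then show ?thesis by simp
  qed
  then show ?thesis using bound(2)[of e] by (simp add: mult.assoc)
qed

theorem corollary7p3:
  fixes \<Lambda> :: "('u::real_normed_vector \<Rightarrow> real) set"
    and V :: "'u data nspace"
    and Adm :: "('u data, 'w::real_vector) restriction set"
    and refined_by :: "('u data, 'w) restriction \<Rightarrow> ('u data, 'w) restriction \<Rightarrow> bool"
    and nWP :: "'u \<Rightarrow> real"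
    and C C_A :: real
    and u_star :: 'u
  assumes "analytic_problem \<Lambda> V"
    and "MRD_discretization V Adm refined_by"
    and "well_posed \<Lambda> V nWP C"
    and "C_A \<ge> 1"
  shows
    "(\<forall>UM. \<forall>\<rho>\<in>Adm. \<forall>uM_star\<in>UM. \<forall>uM_tilde\<in>UM.
        subspace UM \<and> finite_dim UM \<and> stable_test \<Lambda> V UM \<rho> \<and>
        rnorm \<rho> (data_map \<Lambda> (u_star - uM_tilde))
          \<le> C_A * rnorm \<rho> (data_map \<Lambda> (u_star - uM_star))
        \<longrightarrow> nWP (u_star - uM_tilde) \<le> C * (2 * C_A + 3) * dnorm \<Lambda> V (uM_star - u_star))
     \<and>
     (\<forall>(F :: 'm filter) UM \<rho> uM_star uM_tilde (g :: 'm \<Rightarrow> real).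
        (\<forall>m. subspace (UM m) \<and> finite_dim (UM m) \<and> \<rho> m \<in> Adm \<and>
             stable_test \<Lambda> V (UM m) (\<rho> m) \<and> uM_star m \<in> UM m \<and> uM_tilde m \<in> UM m \<and>
             rnorm (\<rho> m) (data_map \<Lambda> (u_star - uM_tilde m))
               \<le> C_A * rnorm (\<rho> m) (data_map \<Lambda> (u_star - uM_star m))) \<and>
        (\<lambda>m. dnorm \<Lambda> V (uM_star m - u_star)) \<in> O[F](g)
        \<longrightarrow> (\<lambda>m. nWP (u_star - uM_tilde m)) \<in> O[F](g))"
proof -
  have bound: "nWP (u_star - t) \<le> C * (2 * C_A + 3) * dnorm \<Lambda> V (s - u_star)"
    if "subspace UM" "stable_test \<Lambda> V UM \<rho>" "\<rho> \<in> Adm" "s \<in> UM" "t \<in> UM"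
      and near_opt: "rnorm \<rho> (data_map \<Lambda> (u_star - t)) \<le> C_A * rnorm \<rho> (data_map \<Lambda> (u_star - s))"
    for UM \<rho> s t
  proof -
    have "s - t \<in> UM" using that by (simp add: subspace_diff)
    then have "dnorm \<Lambda> V (s - t) \<le> 2 * rnorm \<rho> (data_map \<Lambda> (s - t))"
      using that unfolding stable_test_def by blast
    then have "dnorm \<Lambda> V (u_star - t) \<le> (2 * C_A + 3) * dnorm \<Lambda> V (s - u_star)"
      using stable_trial_quasi_optimal[OF seminorm_dnorm[OF assms(1)]
          seminorm_rnorm[OF assms(1,2) \<open>\<rho> \<in> Adm\<close>] rnorm_le_dnorm[OF assms(1,2) \<open>\<rho> \<in> Adm\<close>]]
        near_opt assms(4) by simp
    then show ?thesis by (rule well_posed_bound_mono[OF assms(1,3)])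
  qed
  have rate: "(\<lambda>m. nWP (u_star - t m)) \<in> O[F](g)"
    if H: "\<forall>m. subspace (UM m) \<and> finite_dim (UM m) \<and> \<rho> m \<in> Adm \<and>
             stable_test \<Lambda> V (UM m) (\<rho> m) \<and> s m \<in> UM m \<and> t m \<in> UM m \<and>
             rnorm (\<rho> m) (data_map \<Lambda> (u_star - t m))
               \<le> C_A * rnorm (\<rho> m) (data_map \<Lambda> (u_star - s m))"
      and O: "(\<lambda>m. dnorm \<Lambda> V (s m - u_star)) \<in> O[F](g)"
    for F :: "'m filter" and UM \<rho> s t and g :: "'m \<Rightarrow> real"
  proof -
    have "norm (nWP (u_star - t m))
        \<le> C * (2 * C_A + 3) * norm (dnorm \<Lambda> V (s m - u_star))" for m
    proof -
      have "0 \<le> nWP (u_star - t m)"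
        using assms(3) by (simp add: well_posed_def norm_on_def)
      moreover have "0 \<le> dnorm \<Lambda> V (s m - u_star)"
        by (rule seminorm_nonneg[OF seminorm_dnorm[OF assms(1)]])
      moreover have "nWP (u_star - t m) \<le> C * (2 * C_A + 3) * dnorm \<Lambda> V (s m - u_star)"
        using bound[of "UM m" "\<rho> m" "s m" "t m"] H by blast
      ultimately show ?thesis by simp
    qed
    then have "(\<lambda>m. nWP (u_star - t m)) \<in> O[F](\<lambda>m. dnorm \<Lambda> V (s m - u_star))"
      by (intro bigoI[where c = "C * (2 * C_A + 3)"] always_eventually allI)
    then show ?thesis using O by (rule landau_o.big_trans)
  qed
  show ?thesis
  proof (intro conjI allI ballI impI, goal_cases)
    case (1 UM \<rho> s t)
    then show ?case by (intro bound[of UM \<rho> s t]) simp_all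
  next
    case (2 F UM \<rho> s t g)
    then show ?case by (elim conjE) (rule rate)
  qed
qed

end
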